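(* For sufficiently large $t$, $$m(P_{2t+1})\le t^{-1/(1+\sqrt{2})+o(1)}\,\frac{t}{2}\,(2t)!,$$ where $o(1)$ denotes a quantity tending to $0$ as $t\to\infty$. That is, there is a function $\varepsilon:\mathbb{N}\to\mathbb{R}$ with $\varepsilon(t)\to 0$ as $t\to\infty$ such that for all sufficiently large integers $t$, $m(P_{2t+1})\le t^{-1/(1+\sqrt{2})+\varepsilon(t)}\,\frac{t}{2}\,(2t)!$.
   Context: $P_n$ denotes the path on $n$ vertices. For a graph $H$, the Ramsey number $r(H)$ is the minimum positive integer $n$ such that every red/blue edge-coloring of the complete graph $K_n$ contains a monochromatic copy of $H$. The threshold Ramsey multiplicity $m(H)$ is the minimum, over all red/blue edge-colorings of $K_{r(H)}$, of the total number of monochromatic copies of $H$ (the number of red copies plus the number of blue copies). A copy of $H$ is an (unlabelled) subgraph of the complete graph isomorphic to $H$; in particular a path and its reversal are the same copy. *)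

theory Defs
  imports Complex_Main "HOL-Library.Ramsey"
begin

text \<open>
  A simple undirected graph is a pair of a vertex set and a set of edges, each edge being a
  two-element set of vertices; \<^term>\<open>nsets V 2\<close> is the edge set of the complete graph on \<^term>\<open>V\<close>.
\<close>

type_synonym 'a ugraph = "'a set \<times> 'a set set"

definition subgraph_of :: "'a ugraph \<Rightarrow> 'a ugraph \<Rightarrow> bool" where
  "subgraph_of G K \<longleftrightarrow> fst G \<subseteq> fst K \<and> snd G \<subseteq> snd K"

definition ugraph_iso :: "'a ugraph \<Rightarrow> 'b ugraph \<Rightarrow> bool" where
  "ugraph_iso G K \<longleftrightarrow> (\<exists>f. bij_betw f (fst G) (fst K) \<and> snd K = (\<lambda>e. f ` e) ` snd G)"

text \<open>Copies are unlabelled: subgraphs are counted, not embeddings.\<close>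

definition copies :: "'a ugraph \<Rightarrow> 'b ugraph \<Rightarrow> 'b ugraph set" where
  "copies H G = {K. subgraph_of K G \<and> ugraph_iso H K}"

definition path_graph :: "nat \<Rightarrow> nat ugraph" where
  "path_graph n = ({..<n}, {{i, Suc i} | i. Suc i < n})"

text \<open>
  A colouring of the edges of \<open>K\<^sub>n\<close>, with vertex set \<^term>\<open>{..<n}\<close>, is given by a function on all
  sets of naturals; its values outside \<^term>\<open>nsets {..<n} 2\<close> are never used.
\<close>

datatype colour = Red | Blue

definition colour_graph :: "nat \<Rightarrow> (nat set \<Rightarrow> colour) \<Rightarrow> colour \<Rightarrow> nat ugraph" where
  "colour_graph n c k = ({..<n}, {e \<in> nsets {..<n} 2. c e = k})"

definition ramsey_number :: "'a ugraph \<Rightarrow> nat" where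
  "ramsey_number H = (LEAST n. n > 0 \<and> (\<forall>c. \<exists>k. copies H (colour_graph n c k) \<noteq> {}))"

definition mono_count :: "'a ugraph \<Rightarrow> nat \<Rightarrow> (nat set \<Rightarrow> colour) \<Rightarrow> nat" where
  "mono_count H n c =
     card (copies H (colour_graph n c Red)) + card (copies H (colour_graph n c Blue))"

definition ramsey_multiplicity :: "'a ugraph \<Rightarrow> nat" where
  "ramsey_multiplicity H = (LEAST m. \<exists>c. m = mono_count H (ramsey_number H) c)"

end

theory Submission
  imports Defs "HOL-Real_Asymp.Real_Asymp"
begin

text \<open>
  Upper bound \<open>r(P\<^sub>2\<^sub>t\<^sub>+\<^sub>1) \<le> 3t\<close> (Gerencser and Gyarfas): off a longest monochromatic path, every
  vertex sees both ends and one of any two consecutive path vertices in the other colour, so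
  alternating between the outside and the path gives a longer path in that colour. Only this upper
  bound on the Ramsey number matters, since restricting a colouring to fewer vertices does not
  increase the number of monochromatic paths.

  First moment: split the \<open>3t\<close> vertices into \<open>A\<close> and \<open>B\<close> of sizes \<open>2t\<close> and \<open>t\<close>, colour \<open>A\<close> red,
  \<open>B\<close> blue, and each edge between them red independently with probability \<open>p = C / (2t)\<close>.
  A blue path must alternate, which gives about \<open>(2t)! t exp (- C)\<close> of them; a red path with \<open>j\<close>
  vertices in \<open>B\<close> uses essentially \<open>2j\<close> random edges, which gives about
  \<open>(2t)! (\<Sum>j. (C\<^sup>2 / 2) ^ j / (j! (j - 1)!))\<close>, that is \<open>(2t)! exp (sqrt 2 C)\<close> up to a factor
  polynomial in \<open>C\<close>. The two balance at \<open>C = ln t / (1 + sqrt 2)\<close>.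
\<close>

section \<open>Monochromatic paths in the complete graph on \<open>3t\<close> vertices\<close>

text \<open>Prepending a pair \<open>z i\<close>, \<open>u\<close> makes \<open>z i\<close> the new
  head, which again sees all of \<open>U\<close>, so the pairs can be used up one at a time.
  Additions go only at the front, which leaves the last vertex free for an extension at the other
  end.\<close>

lemma successively_interleave:
  assumes "symp E" "finite I" "card U = card I" "finite U"
    and "distinct ys" "successively E ys" "ys \<noteq> []" "set ys \<inter> U = {}"
    and "\<And>i. i \<in> I \<Longrightarrow> z i \<notin> set ys \<union> U" "inj_on z I"
    and "\<And>u. u \<in> U \<Longrightarrow> E (hd ys) u" "\<And>i u. i \<in> I \<Longrightarrow> u \<in> U \<Longrightarrow> E (z i) u"
  shows "\<exists>xs. distinct xs \<and> successively E xs \<and> xs \<noteq> [] \<and> last xs = last ys \<and>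
    set xs \<subseteq> set ys \<union> U \<union> z ` I \<and> length xs = length ys + 2 * card I"
  using assms
proof (induction "card I" arbitrary: I U ys)
  case 0
  then show ?case by auto
next
  case (Suc n)
  then obtain i u where i: "i \<in> I" and u: "u \<in> U"
    by (metis Zero_not_Suc card.empty ex_in_conv)
  let ?ys = "z i # u # ys"
  have z: "z j \<noteq> z i" if "j \<in> I - {i}" for j
    using that i Suc.prems(10) by (auto dest: inj_onD)
  have c: "card (I - {i}) = n" "card (U - {u}) = n"
    using Suc.hyps(2) Suc.prems i u by auto
  have "E u (hd ys)" "E (z i) u"
    using Suc.prems i u by (auto dest: sympD)
  then have "\<exists>xs. distinct xs \<and> successively E xs \<and> xs \<noteq> [] \<and> last xs = last ?ys \<and>
    set xs \<subseteq> set ?ys \<union> (U - {u}) \<union> z ` (I - {i}) \<and> length xs = length ?ys + 2 * card (I - {i})"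
    using Suc.prems i u c z
    by (intro Suc.hyps(1)) (auto simp: successively_Cons inj_on_diff)
  then show ?case
    using i u c Suc.hyps(2) Suc.prems(7) by (elim ex_forward) fastforce
qed

text \<open>The cells stand for pairs of consecutive vertices of an old path and \<open>U\<close>
  for vertices off it. As long as the head reaches some \<open>u\<close> in \<open>U\<close> through
  a cell, one cell and one vertex of \<open>U\<close> are spent. Once this gets stuck, every
  remaining cell has a vertex that sees all of \<open>U\<close>, and prepending the hub
  \<open>b\<close> and then alternating finishes. In total two vertices per cell and
  \<open>b\<close> are gained.\<close>

lemma successively_through_cells:
  assumes sym: "symp E" and "finite I" "finite U" "card U = card I"
    and "distinct xs" "successively E xs" "xs \<noteq> []" "set xs \<inter> U = {}"
    and "b \<notin> set xs \<union> U" "E (hd xs) b" "\<And>u. u \<in> U \<Longrightarrow> E b u"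
    and "\<And>i. i \<in> I \<Longrightarrow> D i \<inter> (set xs \<union> U \<union> {b}) = {}"
    and "\<And>i j. i \<in> I \<Longrightarrow> j \<in> I \<Longrightarrow> i \<noteq> j \<Longrightarrow> D i \<inter> D j = {}"
    and "\<And>i r. i \<in> I \<Longrightarrow> r \<in> insert (hd xs) U \<Longrightarrow> \<exists>v\<in>D i. E r v"
    and "\<And>i v. i \<in> I \<Longrightarrow> v \<in> D i \<Longrightarrow> \<exists>v'\<in>D i. \<forall>u\<in>U. E u v \<or> E u v'"
  shows "\<exists>ys. distinct ys \<and> successively E ys \<and> ys \<noteq> [] \<and> last ys = last xs \<and>
    set ys \<subseteq> set xs \<union> U \<union> {b} \<union> (\<Union>i\<in>I. D i) \<and> length ys = length xs + 2 * card I + 1"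
  using assms(2-)
proof (induction "card I" arbitrary: I U xs)
  case 0
  then have "I = {}" by simp
  have "E b (hd xs)" by (rule sympD[OF sym 0(10)])
  with 0(5-7,9) \<open>I = {}\<close> show ?case
    by (intro exI[of _ "b # xs"]) (auto simp add: successively_Cons)
next
  case (Suc n)
  note fin = Suc.prems(1,2) and card = Suc.prems(3) and xs = Suc.prems(4-7)
    and b = Suc.prems(8-10) and disj = Suc.prems(11,12) and cell = Suc.prems(13,14)
  show ?case
  proof (cases "\<exists>i\<in>I. \<exists>v\<in>D i. \<exists>u\<in>U. E (hd xs) v \<and> E v u")
    case True
    then obtain i v u where i: "i \<in> I" and v: "v \<in> D i" and u: "u \<in> U"
      and E: "E (hd xs) v" "E v u" by blast
    let ?xs = "u # v # xs"
    have v': "v \<notin> set xs" "v \<notin> U" "v \<noteq> b" "u \<notin> set xs" "u \<noteq> b" "u \<noteq> v"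
      using v u disj(1)[OF i] xs(4) b(1) by auto
    have c: "card (I - {i}) = n" "card (U - {u}) = n"
      using Suc.hyps(2) card fin i u by auto
    have "\<exists>ys. distinct ys \<and> successively E ys \<and> ys \<noteq> [] \<and> last ys = last ?xs \<and>
      set ys \<subseteq> set ?xs \<union> (U - {u}) \<union> {b} \<union> (\<Union>i\<in>I - {i}. D i) \<and>
      length ys = length ?xs + 2 * card (I - {i}) + 1"
    proof (rule Suc.hyps(1))
      show "distinct ?xs" using xs(1) v' by auto
      show "successively E ?xs"
        using E xs(2) sympD[OF sym E(1)] sympD[OF sym E(2)] by (auto simp: successively_Cons)
      show "D j \<inter> (set ?xs \<union> (U - {u}) \<union> {b}) = {}" if "j \<in> I - {i}" for j
        using disj(1)[of j] disj(2)[of i j] that i u v by auto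
      show "\<exists>v\<in>D j. E r v" if "j \<in> I - {i}" "r \<in> insert (hd ?xs) (U - {u})" for j r
        using cell(1)[of j r] that u by auto
      show "set ?xs \<inter> (U - {u}) = {}" using xs(4) v' by auto
      show "b \<notin> set ?xs \<union> (U - {u})" using b(1) v' by auto
      show "\<exists>v'\<in>D j. \<forall>u\<in>U - {u}. E u v \<or> E u v'" if "j \<in> I - {i}" "v \<in> D j" for j v
        using cell(2)[of j v] that by auto
      show "E (hd ?xs) b" using sympD[OF sym b(3)[OF u]] by simp
      show "D j \<inter> D k = {}" if "j \<in> I - {i}" "k \<in> I - {i}" "j \<noteq> k" for j k
        using disj(2) that by blast
      show "E b w" if "w \<in> U - {u}" for w using b(3) that by blast
    qed (use c fin in auto)
    then obtain ys where ys: "distinct ys" "successively E ys" "ys \<noteq> []" "last ys = last ?xs"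
      "set ys \<subseteq> set ?xs \<union> (U - {u}) \<union> {b} \<union> (\<Union>i\<in>I - {i}. D i)"
      "length ys = length ?xs + 2 * card (I - {i}) + 1" by blast
    have "set ys \<subseteq> set xs \<union> U \<union> {b} \<union> (\<Union>i\<in>I. D i)" using ys(5) i v u by auto
    moreover have "length ys = length xs + 2 * card I + 1" using ys(6) c Suc.hyps(2) by simp
    ultimately show ?thesis using ys(1-4) xs(3) by (intro exI[of _ ys]) simp
  next
    case False
    \<comment> \<open>A cell neighbour \<open>v\<close> of the head now sees nothing in
      \<open>U\<close>, so by the last hypothesis its partner \<open>v'\<close> in the cell sees all
      of \<open>U\<close>.\<close>
    have "\<forall>i\<in>I. \<exists>v\<in>D i. \<forall>u\<in>U. E v u"
    proof
      fix i assume i: "i \<in> I"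
      obtain v where v: "v \<in> D i" "E (hd xs) v" using cell(1)[OF i] by blast
      then have "\<not> E u v" if "u \<in> U" for u
        using False i that sympD[OF sym, of u v] by blast
      then show "\<exists>v\<in>D i. \<forall>u\<in>U. E v u"
        using cell(2)[OF i v(1)] by (metis sympD[OF sym])
    qed
    then have "\<exists>z. \<forall>i\<in>I. z i \<in> D i \<and> (\<forall>u\<in>U. E (z i) u)"
      by (intro bchoice) blast
    then obtain z where z: "\<And>i. i \<in> I \<Longrightarrow> z i \<in> D i" "\<And>i u. i \<in> I \<Longrightarrow> u \<in> U \<Longrightarrow> E (z i) u"
      by blast
    have "\<exists>ys. distinct ys \<and> successively E ys \<and> ys \<noteq> [] \<and> last ys = last (b # xs) \<and>
      set ys \<subseteq> set (b # xs) \<union> U \<union> z ` I \<and> length ys = length (b # xs) + 2 * card I"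
    proof (rule successively_interleave)
      show "inj_on z I"
      proof (rule inj_onI, rule ccontr)
        fix i j assume "i \<in> I" "j \<in> I" "z i = z j" "i \<noteq> j"
        then show False using z(1)[of i] z(1)[of j] disj(2)[of i j] by auto
      qed
      show "z i \<notin> set (b # xs) \<union> U" if "i \<in> I" for i
        using z(1)[OF that] disj(1)[OF that] by auto
      show "successively E (b # xs)"
        using xs sympD[OF sym b(2)] by (simp add: successively_Cons)
      show "distinct (b # xs)" "set (b # xs) \<inter> U = {}" using xs b(1) by auto
      show "E (z i) u" if "i \<in> I" "u \<in> U" for i u using z(2) that .
      show "E (hd (b # xs)) u" if "u \<in> U" for u using b(3) that by simp
    qed (use sym fin card in auto)
    then obtain ys where ys: "distinct ys" "successively E ys" "ys \<noteq> []" "last ys = last (b # xs)"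
      "set ys \<subseteq> set (b # xs) \<union> U \<union> z ` I" "length ys = length (b # xs) + 2 * card I" by blast
    have "set ys \<subseteq> set xs \<union> U \<union> {b} \<union> (\<Union>i\<in>I. D i)" using ys(5) z(1) by auto
    then show ?thesis using ys(1-4,6) xs(3) by (intro exI[of _ ys]) simp
  qed
qed

text \<open>If the longer of the two colours' longest paths is \<open>xs\<close>, maximality makes both of its ends
  adjacent in the other colour to every vertex off \<open>xs\<close>, and makes every such vertex adjacent in
  the other colour to one of any two consecutive vertices of \<open>xs\<close>.\<close>

lemma longer_path_in_other_colour:
  assumes V: "finite V" "set xs \<subseteq> V" and xs: "distinct xs" "successively E xs"
    and len: "length xs \<ge> 2" "card V \<ge> length xs + (length xs + 1) div 2"
    and sym: "symp E" "symp E'" and E': "\<And>a b. a \<in> V \<Longrightarrow> b \<in> V \<Longrightarrow> a \<noteq> b \<Longrightarrow> E a b \<or> E' a b"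
    and max: "\<And>ys. set ys \<subseteq> V \<Longrightarrow> distinct ys \<Longrightarrow> successively E ys \<Longrightarrow> length ys \<le> length xs"
  shows "\<exists>ys. set ys \<subseteq> V \<and> distinct ys \<and> successively E' ys \<and> length ys = length xs + 1"
proof -
  define m where "m = length xs"
  define s where "s = m div 2"
  \<comment> \<open>The pairs start at index 1. For \<open>i < s - 1\<close> they stay strictly
    between the two ends, which are kept as start and hub.\<close>
  define D where "D = (\<lambda>i. {xs ! (2 * i + 1), xs ! (2 * i + 2)})"
  have s: "s \<ge> 1" "2 * s \<le> m" "m \<le> 2 * s + 1" using len(1) by (auto simp: s_def m_def)
  have ne: "xs \<noteq> []" using len(1) by auto
  let ?R = "V - set xs"
  have R: "card ?R = card V - m"
    using V xs(1) by (simp add: card_Diff_subset distinct_card m_def)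
  then have "card ?R \<ge> s" using len(2) s by (simp add: m_def)
  then obtain R0 where R0: "R0 \<subseteq> ?R" "card R0 = s" "finite R0"
    using obtain_subset_with_card_n by (metis V(1) finite_Diff finite_subset)
  then obtain r where r: "r \<in> R0" using s by (metis One_nat_def card.empty ex_in_conv not_one_le_zero)
  have hd: "E' (hd xs) u" if "u \<in> ?R" for u
  proof (rule ccontr)
    assume n: "\<not> E' (hd xs) u"
    have "hd xs \<in> V" "u \<in> V" "hd xs \<noteq> u" using that V ne hd_in_set[OF ne] by auto
    then have "E u (hd xs)" using E' n sympD[OF sym(1)] by blast
    then have "length (u # xs) \<le> length xs"
      using that V xs ne by (intro max) (auto simp: successively_Cons)
    then show False by simp
  qed
  have last: "E' (last xs) u" if "u \<in> ?R" for u
  proof (rule ccontr)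
    assume n: "\<not> E' (last xs) u"
    have "last xs \<in> V" "u \<in> V" "last xs \<noteq> u" using that V ne last_in_set[OF ne] by auto
    then have "E (last xs) u" using E' n by blast
    then have "length (xs @ [u]) \<le> length xs"
      using that V xs ne by (intro max) (auto simp: successively_append_iff)
    then show False by simp
  qed
  have mid: "E' u (xs ! j) \<or> E' u (xs ! Suc j)" if u: "u \<in> ?R" and j: "Suc j < m" for u j
  proof (rule ccontr)
    assume n: "\<not> (E' u (xs ! j) \<or> E' u (xs ! Suc j))"
    have jV: "xs ! j \<in> V" "xs ! Suc j \<in> V" "u \<noteq> xs ! j" "u \<noteq> xs ! Suc j"
      using u j V nth_mem[of j xs] nth_mem[of "Suc j" xs] by (auto simp: m_def)
    then have e: "E (xs ! j) u" "E u (xs ! Suc j)" using E' n u sympD[OF sym(1)] by blast+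
    let ?a = "take (Suc j) xs" and ?b = "drop (Suc j) xs"
    have "successively E (?a @ ?b)" using xs by simp
    then have ab: "successively E ?a" "successively E ?b" unfolding successively_append_iff by auto
    have "last ?a = xs ! j" "hd ?b = xs ! Suc j"
      using j by (simp_all add: take_Suc_conv_app_nth hd_drop_conv_nth m_def)
    then have "successively E (?a @ u # ?b)" using ab e
      by (simp add: successively_append_iff successively_Cons)
    moreover have "distinct (?a @ u # ?b)"
      using xs(1) u set_take_disj_set_drop_if_distinct[OF xs(1), of "Suc j" "Suc j"]
      by (auto dest: in_set_takeD in_set_dropD)
    moreover have "set (?a @ u # ?b) \<subseteq> V"
      using u V by (auto dest: in_set_takeD in_set_dropD)
    ultimately have "length (?a @ u # ?b) \<le> length xs" by (intro max)
    then show False using j by (simp add: m_def)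
  qed
  have idx: "2 * i + 2 < m - 1" if "i < s - 1" for i using that s by linarith
  have nth_eq: "xs ! i = xs ! j \<longleftrightarrow> i = j" if "i < m" "j < m" for i j
    using that xs(1) by (simp add: nth_eq_iff_index_eq m_def)
  have hdlast: "hd xs = xs ! 0" "last xs = xs ! (m - 1)"
    using ne by (simp_all add: hd_conv_nth last_conv_nth m_def)
  have inxs: "xs ! i \<in> set xs" if "i < m" for i using that by (simp add: m_def)
  \<comment> \<open>Start from \<open>[r, hd xs]\<close>, with the \<open>s - 1\<close> other
    vertices of \<open>R0\<close> as \<open>U\<close> and \<open>last xs\<close> as
    \<open>b\<close>. The new path has 2 + 2 (s - 1) + 1 = 2 s + 1 vertices and ends in
    \<open>hd xs\<close>.\<close>
  have "\<exists>ys. distinct ys \<and> successively E' ys \<and> ys \<noteq> [] \<and> last ys = last [r, hd xs] \<and>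
    set ys \<subseteq> set [r, hd xs] \<union> (R0 - {r}) \<union> {last xs} \<union> (\<Union>i\<in>{..<s - 1}. D i) \<and>
    length ys = length [r, hd xs] + 2 * card {..<s - 1} + 1"
  proof (rule successively_through_cells)
    show "card (R0 - {r}) = card {..<s - 1}" using r R0 by simp
    have "r \<noteq> hd xs" using r R0(1) hd_in_set[OF ne] by auto
    then show "distinct [r, hd xs]" by simp
    show "successively E' [r, hd xs]" using hd[of r] r R0(1) sympD[OF sym(2)] by auto
    show "set [r, hd xs] \<inter> (R0 - {r}) = {}" using R0(1) hd_in_set[OF ne] by auto
    have "last xs \<noteq> hd xs" using nth_eq[of "m - 1" 0] s(1,2) unfolding hdlast by linarith
    then show "last xs \<notin> set [r, hd xs] \<union> (R0 - {r})"
      using r R0(1) last_in_set[OF ne] by auto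
    show "E' (hd [r, hd xs]) (last xs)" using last[of r] r R0(1) sympD[OF sym(2)] by auto
    show "E' (last xs) u" if "u \<in> R0 - {r}" for u using last that R0(1) by blast
    show "D i \<inter> (set [r, hd xs] \<union> (R0 - {r}) \<union> {last xs}) = {}" if "i \<in> {..<s - 1}" for i
    proof -
      have i: "2 * i + 2 < m - 1" using idx that by simp
      have "D i \<subseteq> set xs" using i inxs by (simp add: D_def)
      moreover have "hd xs \<notin> D i" "last xs \<notin> D i"
        using i by (simp_all add: D_def hdlast nth_eq)
      ultimately show ?thesis using R0(1) r by auto
    qed
    show "D i \<inter> D j = {}" if "i \<in> {..<s - 1}" "j \<in> {..<s - 1}" "i \<noteq> j" for i j
    proof -
      have "2 * i + 2 < m" "2 * j + 2 < m" using idx[of i] idx[of j] that by auto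
      moreover have "2 * i + 1 \<noteq> 2 * j + 2" "2 * i + 2 \<noteq> 2 * j + 1" by presburger+
      ultimately show ?thesis using that(3) by (simp add: D_def nth_eq)
    qed
    have key: "E' u (xs ! (2 * i + 1)) \<or> E' u (xs ! (2 * i + 2))" if "i < s - 1" "u \<in> R0" for i u
      using mid[of u "2 * i + 1"] idx[OF that(1)] that(2) R0(1) by auto
    show "\<exists>v\<in>D i. E' u v" if "i \<in> {..<s - 1}" "u \<in> insert (hd [r, hd xs]) (R0 - {r})" for i u
      using key[of i u] that r by (auto simp: D_def)
    show "\<exists>v'\<in>D i. \<forall>u\<in>R0 - {r}. E' u v \<or> E' u v'" if i: "i \<in> {..<s - 1}" and v: "v \<in> D i" for i v
    proof -
      obtain v' where v': "v' \<in> D i" "{xs ! (2 * i + 1), xs ! (2 * i + 2)} = {v, v'}"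
        using v unfolding D_def by blast
      have "E' u v \<or> E' u v'" if "u \<in> R0" for u
        using key[of i u] i that v'(2) by (auto simp: doubleton_eq_iff)
      with v'(1) show ?thesis by blast
    qed
  qed (use sym(2) R0(3) in simp_all)
  then obtain ys where ys: "distinct ys" "successively E' ys" "ys \<noteq> []" "last ys = hd xs"
    "set ys \<subseteq> set [r, hd xs] \<union> (R0 - {r}) \<union> {last xs} \<union> (\<Union>i\<in>{..<s - 1}. D i)"
    "length ys = 2 * s + 1" using s by (auto simp: numeral_eq_Suc)
  have "D i \<subseteq> set xs" if "i < s - 1" for i using idx[OF that] inxs by (simp add: D_def)
  then have sub: "set ys \<subseteq> set xs \<union> R0"
    using ys(5) r hd_in_set[OF ne] last_in_set[OF ne] by (simp add: subset_iff) blast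
  show ?thesis
  proof (cases "m = 2 * s")
    case True
    then show ?thesis using ys sub R0(1) V by (intro exI[of _ ys]) (auto simp: m_def)
  next
    case False
    then have m: "m = 2 * s + 1" using s by simp
    \<comment> \<open>For odd \<open>m\<close> one vertex is still missing. The path ends in
      \<open>hd xs\<close>, which sees every vertex off \<open>xs\<close> in the other colour, and
      the size of \<open>V\<close> leaves such a vertex outside \<open>R0\<close>.\<close>
    then have "card ?R > card R0" using R R0(2) len(2) by (simp add: m_def)
    then obtain r' where r': "r' \<in> ?R" "r' \<notin> R0"
      by (metis R0(3) card_mono linorder_not_less subsetI)
    have "successively E' (ys @ [r'])"
      using ys hd[OF r'(1)] by (simp add: successively_append_iff)
    moreover have "distinct (ys @ [r'])" using ys(1) sub r' by auto
    ultimately show ?thesis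
      using ys sub r' R0(1) V m by (intro exI[of _ "ys @ [r']"]) (auto simp: m_def)
  qed
qed

section \<open>Paths as injective maps, and the Ramsey bound\<close>

definition path_maps :: "nat \<Rightarrow> 'a ugraph \<Rightarrow> (nat \<Rightarrow> 'a) set" where
  "path_maps n G = {f \<in> {..<n} \<rightarrow>\<^sub>E fst G. inj_on f {..<n} \<and>
     (\<forall>i. Suc i < n \<longrightarrow> {f i, f (Suc i)} \<in> snd G)}"

lemma image_path_edges:
  "(`) f ` snd (path_graph n) = {{f i, f (Suc i)} | i. Suc i < n}"
  by (auto simp: path_graph_def image_iff) blast

lemma finite_path_maps: "finite (fst G) \<Longrightarrow> finite (path_maps n G)"
  by (rule finite_subset[of _ "{..<n} \<rightarrow>\<^sub>E fst G"]) (auto simp: path_maps_def intro: finite_PiE)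

text \<open>An isomorphism from the path graph, restricted to the positions to make it extensional,
  traces the copy. A copy with at least two vertices is traced by two maps, one per direction; the
  lost factor 2 ends up in \<open>\<epsilon>\<close>.\<close>

lemma copies_path_subset:
  "copies (path_graph n) G \<subseteq>
    (\<lambda>f. (f ` {..<n}, {{f i, f (Suc i)} | i. Suc i < n})) ` path_maps n G"
proof
  fix K assume "K \<in> copies (path_graph n) G"
  then obtain f where sub: "fst K \<subseteq> fst G" "snd K \<subseteq> snd G"
    and f: "bij_betw f {..<n} (fst K)" "snd K = (`) f ` snd (path_graph n)"
    by (auto simp: copies_def subgraph_of_def ugraph_iso_def path_graph_def)
  let ?f = "restrict f {..<n}"
  have "{{?f i, ?f (Suc i)} | i. Suc i < n} = {{f i, f (Suc i)} | i. Suc i < n}"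
    by (intro Collect_cong ex_cong) auto
  then have K: "snd K = {{?f i, ?f (Suc i)} | i. Suc i < n}" "fst K = ?f ` {..<n}"
    using f by (auto simp: image_path_edges bij_betw_def)
  have "{?f i, ?f (Suc i)} \<in> snd G" if "Suc i < n" for i
    using sub(2) that unfolding K by blast
  then have "?f \<in> path_maps n G"
    using f(1) sub(1) by (auto simp: path_maps_def bij_betw_def inj_on_restrict_eq)
  then show "K \<in> (\<lambda>f. (f ` {..<n}, {{f i, f (Suc i)} | i. Suc i < n})) ` path_maps n G"
    by (rule rev_image_eqI) (use K in \<open>simp add: prod_eq_iff\<close>)
qed

lemma card_copies_path_le:
  "finite (fst G) \<Longrightarrow> card (copies (path_graph n) G) \<le> card (path_maps n G)"
  using surj_card_le[OF finite_path_maps copies_path_subset] .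

lemma copies_path_nonempty:
  assumes "distinct xs" "set xs \<subseteq> fst G" "successively (\<lambda>a b. {a, b} \<in> snd G) xs"
    and "n \<le> length xs"
  shows "copies (path_graph n) G \<noteq> {}"
proof -
  let ?K = "((!) xs ` {..<n}, (`) ((!) xs) ` snd (path_graph n))"
  have "{xs ! i, xs ! Suc i} \<in> snd G" if "Suc i < length xs" for i
    using assms(3) that by (simp add: successively_conv_nth)
  then have "subgraph_of ?K G"
    using assms(2,4) by (auto simp: subgraph_of_def image_path_edges)
  moreover have "ugraph_iso (path_graph n) ?K"
    unfolding ugraph_iso_def using assms(1,4)
    by (intro exI[of _ "(!) xs"])
      (auto simp: path_graph_def bij_betw_def inj_on_def nth_eq_iff_index_eq)
  ultimately show ?thesis unfolding copies_def by blast
qed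

text \<open>Take a path that is longest among both colours together. If it had at most 2t vertices,
  its length plus half of it, rounded up, would not exceed 3t, so the other colour would contain a
  longer path.\<close>

theorem mono_path_exists:
  assumes t: "t > 0"
  shows "\<exists>k. copies (path_graph (2 * t + 1)) (colour_graph (3 * t) c k) \<noteq> {}"
proof -
  let ?V = "{..<3 * t}"
  \<comment> \<open>The colouring also has values on singletons. Demanding
    \<open>a \<noteq> b\<close> discards these and puts each edge into \<open>nsets\<close>.\<close>
  define E where "E = (\<lambda>k a b. a \<noteq> b \<and> c {a, b} = k)"
  define P where "P = (\<lambda>(k, ys). set ys \<subseteq> ?V \<and> distinct ys \<and> successively (E k) ys)"
  have bound: "\<forall>y. P y \<longrightarrow> length (snd y) < Suc (3 * t)"
    unfolding P_def by (auto dest!: card_mono[OF finite_lessThan] simp: distinct_card)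
  \<comment> \<open>A single edge in its own colour shows that a longest path exists and has at
    least two vertices.\<close>
  have "P (c {0, 1}, [0, 1])" using t by (auto simp: P_def E_def)
  then obtain y where y: "P y" "\<And>z. P z \<Longrightarrow> length (snd z) \<le> length (snd y)"
    using ex_has_greatest_nat[OF _ bound] by blast
  obtain k xs where kxs: "y = (k, xs)" by fastforce
  have xs: "set xs \<subseteq> ?V" "distinct xs" "successively (E k) xs"
    using y(1) by (auto simp: P_def kxs)
  have max: "length zs \<le> length xs" if "P (j, zs)" for j zs
    using y(2)[OF that] by (simp add: kxs)
  show ?thesis
  proof (cases "length xs \<ge> 2 * t + 1")
    case True
    have "successively (\<lambda>a b. {a, b} \<in> snd (colour_graph (3 * t) c k)) xs"
      using xs(3) by (rule successively_mono) (use xs(1) in \<open>auto simp: E_def colour_graph_def\<close>)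
    then have "copies (path_graph (2 * t + 1)) (colour_graph (3 * t) c k) \<noteq> {}"
      using xs True by (intro copies_path_nonempty) (auto simp: colour_graph_def)
    then show ?thesis by blast
  next
    case False
    define k' where "k' = (if k = Red then Blue else Red)"
    have k': "j = k \<or> j = k'" for j by (cases j; cases k) (auto simp: k'_def)
    have "\<exists>ys. set ys \<subseteq> ?V \<and> distinct ys \<and> successively (E k') ys \<and> length ys = length xs + 1"
    proof (rule longer_path_in_other_colour)
      show "length xs \<ge> 2" using max[OF \<open>P (c {0, 1}, [0, 1])\<close>] by simp
      show "length xs + (length xs + 1) div 2 \<le> card ?V" using False by simp
      show "symp (E k)" "symp (E k')" by (auto simp: E_def symp_def insert_commute)
      show "E k a b \<or> E k' a b" if "a \<noteq> b" for a b using that k' by (auto simp: E_def)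
      show "length ys \<le> length xs" if "set ys \<subseteq> ?V" "distinct ys" "successively (E k) ys" for ys
        using that by (intro max) (simp add: P_def)
    qed (use xs in auto)
    then obtain ys where "P (k', ys)" "length ys = length xs + 1" by (auto simp: P_def)
    then show ?thesis using max by fastforce
  qed
qed

corollary ramsey_number_path_le: "t > 0 \<Longrightarrow> ramsey_number (path_graph (2 * t + 1)) \<le> 3 * t"
  unfolding ramsey_number_def by (intro Least_le) (use mono_path_exists in auto)

section \<open>Random subsets and injections\<close>

text \<open>The probability that a random subset of \<open>E\<close>, containing each element
  independently with probability \<open>p\<close>, equals \<open>S\<close>.\<close>

definition subset_weight :: "real \<Rightarrow> 'a set \<Rightarrow> 'a set \<Rightarrow> real" where
  "subset_weight p E S = p ^ card S * (1 - p) ^ card (E - S)"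

lemma subset_weight_nonneg: "0 \<le> p \<Longrightarrow> p \<le> 1 \<Longrightarrow> 0 \<le> subset_weight p E S"
  by (simp add: subset_weight_def)

text \<open>Expand the product over \<open>E\<close> with factor \<open>p\<close> on
  \<open>X\<close> and \<open>p + (1 - p)\<close> elsewhere: each subset gives one term, which
  vanishes unless it contains \<open>X\<close>.\<close>

lemma sum_subset_weight_superset:
  assumes "finite E" "X \<subseteq> E"
  shows "(\<Sum>S | S \<subseteq> E \<and> X \<subseteq> S. subset_weight p E S) = p ^ card X"
proof -
  have "p ^ card X = (\<Prod>e\<in>E. p + (if e \<in> X then 0 else 1 - p))"
    using assms by (simp add: if_distrib[of "(+) p"] prod.If_cases Int_absorb1 cong: if_cong)
  also have "\<dots> = (\<Sum>S\<in>Pow E. (\<Prod>e\<in>S. p) * (\<Prod>e\<in>E - S. if e \<in> X then 0 else 1 - p))"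
    by (rule prod_add) fact
  also have "\<dots> = (\<Sum>S\<in>Pow E. if X \<subseteq> S then subset_weight p E S else 0)"
  proof (rule sum.cong[OF refl])
    fix S assume "S \<in> Pow E"
    then have fin: "finite (E - S)" "(E - S) \<inter> X = {} \<longleftrightarrow> X \<subseteq> S"
      using assms by auto
    then have "(\<Prod>e\<in>E - S. if e \<in> X then 0 else 1 - p) = (if X \<subseteq> S then (1 - p) ^ card (E - S) else 0)"
    proof (cases "X \<subseteq> S")
      case True
      then have "(\<Prod>e\<in>E - S. if e \<in> X then 0 else 1 - p) = (\<Prod>e\<in>E - S. 1 - p)"
        by (intro prod.cong) auto
      with True show ?thesis by simp
    next
      case False
      then have "\<exists>e\<in>E - S. (if e \<in> X then 0 else 1 - p) = 0" using fin(2) by auto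
      with False fin(1) show ?thesis by (simp add: prod_zero_iff)
    qed
    then show "(\<Prod>e\<in>S. p) * (\<Prod>e\<in>E - S. if e \<in> X then 0 else 1 - p) =
        (if X \<subseteq> S then subset_weight p E S else 0)"
      by (simp add: subset_weight_def)
  qed
  also have "\<dots> = (\<Sum>S | S \<subseteq> E \<and> X \<subseteq> S. subset_weight p E S)"
    using assms(1) by (intro sum.mono_neutral_cong_right) auto
  finally show ?thesis by simp
qed

lemma sum_subset_weight: "finite E \<Longrightarrow> (\<Sum>S\<in>Pow E. subset_weight p E S) = 1"
  using sum_subset_weight_superset[of E "{}" p] by (simp add: Pow_def)

text \<open>Complementation exchanges \<open>p\<close> and \<open>1 - p\<close> and turns avoiding
  \<open>X\<close> into containing it.\<close>

lemma sum_subset_weight_disjoint: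
  assumes E: "finite E" "X \<subseteq> E"
  shows "(\<Sum>S | S \<subseteq> E \<and> S \<inter> X = {}. subset_weight p E S) = (1 - p) ^ card X"
proof -
  have "(\<Sum>S | S \<subseteq> E \<and> S \<inter> X = {}. subset_weight p E S) =
      (\<Sum>S | S \<subseteq> E \<and> X \<subseteq> S. subset_weight (1 - p) E S)"
    by (rule sum.reindex_bij_witness[of _ "\<lambda>S. E - S" "\<lambda>S. E - S"])
      (use E in \<open>auto simp: subset_weight_def double_diff\<close>)
  then show ?thesis using sum_subset_weight_superset[OF E] by simp
qed

text \<open>The first moment principle. If every value exceeded the average, so would the average
  itself; the comparison is strict because some weight is nonzero.\<close>

lemma exists_le_weighted_average:
  fixes w g :: "'a \<Rightarrow> real"
  assumes "finite A" "\<And>x. x \<in> A \<Longrightarrow> w x \<ge> 0" "sum w A = 1"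
  shows "\<exists>x\<in>A. g x \<le> (\<Sum>y\<in>A. w y * g y)"
proof (rule ccontr)
  let ?m = "\<Sum>y\<in>A. w y * g y"
  assume "\<not> ?thesis"
  then have less: "\<And>x. x \<in> A \<Longrightarrow> ?m < g x" by auto
  obtain x where x: "x \<in> A" "w x \<noteq> 0" using assms(3) sum.neutral[of A w] zero_neq_one by metis
  have "(\<Sum>y\<in>A. w y * ?m) < ?m"
  proof (rule sum_strict_mono_ex1)
    show "\<exists>x\<in>A. w x * ?m < w x * g x"
      using x less assms(2)[OF x(1)] by (intro bexI[of _ x]) (auto intro!: mult_strict_left_mono simp: less_le)
    show "\<forall>x\<in>A. w x * ?m \<le> w x * g x"
      using less assms(2) by (auto intro: mult_left_mono less_imp_le)
  qed (use assms(1) in simp)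
  then show False using assms(3) by (simp flip: sum_distrib_right)
qed

text \<open>Linearity of expectation: \<open>card\<close> is a sum of indicators, so the two
  summations can be exchanged.\<close>

lemma weighted_sum_card:
  fixes w :: "'a \<Rightarrow> real"
  assumes "finite A" "finite F"
  shows "(\<Sum>x\<in>A. w x * card {f \<in> F. Q x f}) = (\<Sum>f\<in>F. \<Sum>x | x \<in> A \<and> Q x f. w x)"
proof -
  have "(\<Sum>x\<in>A. w x * card {f \<in> F. Q x f}) = (\<Sum>x\<in>A. \<Sum>f\<in>F. if Q x f then w x else 0)"
    using assms(2) by (intro sum.cong refl) (simp add: sum.If_cases Int_def mult.commute)
  also have "\<dots> = (\<Sum>f\<in>F. \<Sum>x\<in>A. if Q x f then w x else 0)" by (rule sum.swap)
  also have "\<dots> = (\<Sum>f\<in>F. \<Sum>x | x \<in> A \<and> Q x f. w x)"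
    using assms(1) by (simp add: sum.inter_filter)
  finally show ?thesis .
qed

section \<open>Counting injective maps\<close>

lemma falling_prod_mult_fact:
  "m \<le> n \<Longrightarrow> (\<Prod>i = 0..<m. n - i) * fact (n - m) = (fact n :: nat)"
proof (induction m)
  case (Suc m)
  then have "fact (n - m) = (n - m) * fact (n - Suc m)"
    by (metis Suc_diff_Suc Suc_le_lessD fact_Suc of_nat_id)
  with Suc show ?case by (simp add: mult.assoc)
qed simp

text \<open>Such a map is determined by an injection of \<open>J\<close> into \<open>B\<close> and
  one of the rest of \<open>I\<close> into \<open>A\<close>. Truncated subtraction makes a product
  vanish when there is no room, so the bound is correct in that case too.\<close>

lemma card_inj_PiE_split:
  assumes "finite I" "finite A" "finite B" "A \<inter> B = {}" "J \<subseteq> I"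
  shows "card {f \<in> I \<rightarrow>\<^sub>E A \<union> B. inj_on f I \<and> {i \<in> I. f i \<in> B} = J}
    \<le> (\<Prod>i = 0..<card J. card B - i) * (\<Prod>i = 0..<card I - card J. card A - i)"
proof -
  let ?F = "{f \<in> I \<rightarrow>\<^sub>E A \<union> B. inj_on f I \<and> {i \<in> I. f i \<in> B} = J}"
  let ?G = "{g \<in> J \<rightarrow>\<^sub>E B. inj_on g J} \<times> {g \<in> (I - J) \<rightarrow>\<^sub>E A. inj_on g (I - J)}"
  have fin: "finite J" "finite (I - J)" using assms finite_subset by auto
  have "card ?F \<le> card ?G"
  proof (rule card_inj_on_le)
    show "inj_on (\<lambda>f. (restrict f J, restrict f (I - J))) ?F"
    proof (rule inj_onI)
      fix f g assume fg: "f \<in> ?F" "g \<in> ?F"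
        "(restrict f J, restrict f (I - J)) = (restrict g J, restrict g (I - J))"
      have "f i = g i" if "i \<in> I" for i
        using fg(3) that by (cases "i \<in> J") (auto dest: fun_cong[of _ _ i] simp: restrict_def)
      then show "f = g" using fg(1,2) by (auto intro: PiE_ext)
    qed
    show "(\<lambda>f. (restrict f J, restrict f (I - J))) ` ?F \<subseteq> ?G"
      by (auto simp: inj_on_restrict_eq PiE_iff split: if_splits intro: inj_on_subset)
    have "finite (J \<rightarrow>\<^sub>E B)" "finite ((I - J) \<rightarrow>\<^sub>E A)"
      using fin assms by (auto intro: finite_PiE)
    then show "finite ?G" by auto
  qed
  also have "\<dots> = (\<Prod>i = 0..<card J. card B - i) * (\<Prod>i = 0..<card I - card J. card A - i)"
    using fin assms card_inj_on_subset_funcset[of J B J]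
      card_inj_on_subset_funcset[of "I - J" A "I - J"]
    by (simp add: card_cartesian_product card_Diff_subset)
  finally show ?thesis .
qed

section \<open>Expected numbers of red and blue paths\<close>

definition cross :: "'a set \<Rightarrow> 'a set \<Rightarrow> 'a set set" where
  "cross A B = {{a, b} | a b. a \<in> A \<and> b \<in> B}"

lemma finite_cross: "finite A \<Longrightarrow> finite B \<Longrightarrow> finite (cross A B)"
  by (rule finite_subset[of _ "Pow (A \<union> B)"]) (auto simp: cross_def)

lemma doubleton_in_cross_iff:
  assumes "A \<inter> B = {}" "x \<in> A \<union> B" "y \<in> A \<union> B"
  shows "{x, y} \<in> cross A B \<longleftrightarrow> (x \<in> B) \<noteq> (y \<in> B)"
  using assms by (auto simp: cross_def doubleton_eq_iff)

text \<open>By injectivity different indices give different edges, so crossing edges can be counted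
  by the steps at which the path changes sides.\<close>

lemma card_path_edges_in_cross:
  assumes "A \<inter> B = {}" "f \<in> {..n} \<rightarrow>\<^sub>E A \<union> B" "inj_on f {..n}"
  shows "card ({{f i, f (Suc i)} | i. i < n} \<inter> cross A B) =
    card {i. i < n \<and> (f i \<in> B) \<noteq> (f (Suc i) \<in> B)}"
proof -
  let ?e = "\<lambda>i. {f i, f (Suc i)}"
  have f: "f i \<in> A \<union> B" if "i \<le> n" for i using assms(2) that by auto
  have "?e i \<in> cross A B \<longleftrightarrow> (f i \<in> B) \<noteq> (f (Suc i) \<in> B)" if "i < n" for i
    using that by (intro doubleton_in_cross_iff assms(1) f) auto
  then have "{?e i | i. i < n} \<inter> cross A B = ?e ` {i. i < n \<and> (f i \<in> B) \<noteq> (f (Suc i) \<in> B)}"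
    by auto
  moreover have "inj_on ?e {..<n}"
  proof (rule inj_onI)
    fix i j assume "i \<in> {..<n}" "j \<in> {..<n}" "?e i = ?e j"
    then show "i = j"
      using inj_on_eq_iff[OF assms(3), of i j] inj_on_eq_iff[OF assms(3), of i "Suc j"]
        inj_on_eq_iff[OF assms(3), of "Suc i" j] by (auto simp: doubleton_eq_iff)
  qed
  ultimately show ?thesis
    by (simp add: card_image inj_on_subset subset_iff)
qed

text \<open>In an independent set of positions every element contributes all of its incident path edges,
  hence weight \<open>2\<close> inside the path and \<open>1\<close> at its two ends.\<close>

lemma card_boundary_independent:
  assumes "J \<subseteq> {..n}" "\<And>i. i \<in> J \<Longrightarrow> Suc i \<notin> J"
  shows "card {i. i < n \<and> (i \<in> J) \<noteq> (Suc i \<in> J)} =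
    (\<Sum>i\<in>J. of_bool (i < n) + of_bool (0 < i))"
proof -
  have fin: "finite J" using assms(1) finite_subset by blast
  have "{i. i < n \<and> (i \<in> J) \<noteq> (Suc i \<in> J)} = (J \<inter> {..<n}) \<union> {i. Suc i \<in> J}"
    using assms by auto
  moreover have "card \<dots> = card (J \<inter> {..<n}) + card {i. Suc i \<in> J}"
    using assms(2) fin by (intro card_Un_disjoint) (auto intro: finite_vimageI[of J Suc, unfolded vimage_def])
  moreover have "card {i. Suc i \<in> J} = card (J \<inter> {0<..})"
    by (rule bij_betw_same_card[of Suc]) (auto simp: bij_betw_def image_iff gr0_conv_Suc)
  moreover have "(\<Sum>i\<in>J. of_bool (i < n) + of_bool (0 < i)) = card (J \<inter> {..<n}) + card (J \<inter> {0<..})"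
    using fin by (simp add: sum.distrib sum_of_bool_eq Int_def)
  ultimately show ?thesis by simp
qed

text \<open>Each of the \<open>t + 1\<close> cells \<open>{2k, 2k + 1}\<close> holds at most one
  element of \<open>I\<close>, hence exactly one. The last cell can only hold 2t, and going down, 2k
  + 2 in \<open>I\<close> excludes 2k + 1 and thereby forces 2k.\<close>

lemma independent_eq_evens:
  assumes "I \<subseteq> {..2 * t}" "\<And>i. i \<in> I \<Longrightarrow> Suc i \<notin> I" "t + 1 \<le> card I"
  shows "I = {i. i \<le> 2 * t \<and> even i}"
proof -
  have "inj_on (\<lambda>i. i div 2) I"
  proof (rule inj_onI)
    fix i j assume ij: "i \<in> I" "j \<in> I" "i div 2 = j div 2"
    have "i = j \<or> i = Suc j \<or> j = Suc i" using ij(3) by presburger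
    then show "i = j" using assms(2) ij(1,2) by blast
  qed
  then have "card ((\<lambda>i. i div 2) ` I) = card I" by (rule card_image)
  moreover have sub: "(\<lambda>i. i div 2) ` I \<subseteq> {..t}" using assms(1) by auto
  ultimately have eq: "(\<lambda>i. i div 2) ` I = {..t}"
    using assms(3) by (intro card_subset_eq) (auto dest: card_mono[OF finite_atMost])
  have cell: "2 * k \<in> I \<or> Suc (2 * k) \<in> I" if "k \<le> t" for k
  proof -
    have "k \<in> (\<lambda>i. i div 2) ` I" using eq that by simp
    then obtain i where i: "i \<in> I" "k = i div 2" by blast
    then have "i = 2 * k \<or> i = Suc (2 * k)" by presburger
    with i(1) show ?thesis by metis
  qed
  have even: "2 * (t - d) \<in> I" if "d \<le> t" for d
    using that
  proof (induction d)
    case 0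
    then show ?case using cell[of t] assms(1) by auto
  next
    case (Suc d)
    moreover have "2 * (t - d) = Suc (Suc (2 * (t - Suc d)))" using Suc.prems by linarith
    ultimately have "Suc (Suc (2 * (t - Suc d))) \<in> I" by simp
    then show ?case using assms(2) cell[of "t - Suc d"] by auto
  qed
  have e: "i \<in> I" if "i \<le> 2 * t" "even i" for i
    using even[of "t - i div 2"] that by auto
  moreover have "even i" if "i \<in> I" for i
  proof (rule ccontr)
    assume "odd i"
    then have "i - 1 \<in> I" "i = Suc (i - 1)" using e[of "i - 1"] assms(1) that by auto
    then show False using assms(2) that by metis
  qed
  ultimately show ?thesis using assms(1) by auto
qed

section \<open>Maps grouped by the positions sent to \<open>B\<close>, and their expected
  counts\<close>

definition inj_maps :: "nat \<Rightarrow> 'a set \<Rightarrow> (nat \<Rightarrow> 'a) set" where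
  "inj_maps n V = {f \<in> {..n} \<rightarrow>\<^sub>E V. inj_on f {..n}}"

lemma finite_inj_maps: "finite V \<Longrightarrow> finite (inj_maps n V)"
  by (rule finite_subset[of _ "{..n} \<rightarrow>\<^sub>E V"]) (auto simp: inj_maps_def intro: finite_PiE)

text \<open>Here \<open>n\<close> is the number of edges of the path, so \<open>Suc n\<close>
  positions are shared between \<open>A\<close> and \<open>B\<close>.\<close>

lemma card_inj_maps_fibre:
  assumes "finite A" "finite B" "A \<inter> B = {}" "J \<subseteq> {..n}"
  shows "card {f \<in> inj_maps n (A \<union> B). {i \<in> {..n}. f i \<in> B} = J}
    \<le> (\<Prod>i = 0..<card J. card B - i) * (\<Prod>i = 0..<Suc n - card J. card A - i)"
  using card_inj_PiE_split[of "{..n}" A B J] assms by (simp add: inj_maps_def conj_assoc)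

text \<open>A single term of the exponential series is at most its sum.\<close>

lemma power_le_fact_mult_exp:
  fixes s :: real
  assumes "s > 0"
  shows "s ^ k \<le> fact k * exp s"
proof -
  have "(\<Sum>i\<in>{k}. inverse (fact i) *\<^sub>R s ^ i) \<le> (\<Sum>i. inverse (fact i) *\<^sub>R s ^ i)"
    using summable_exp_generic[of s] assms by (intro sum_le_suminf) auto
  then show ?thesis by (simp add: exp_def field_simps)
qed

text \<open>Bounding \<open>1 / (j - 1)!\<close> by \<open>exp s / s ^ (j - 1)\<close> turns the sum over subsets into a
  product; \<open>s = sqrt (sum w I)\<close> is the optimal choice.\<close>

lemma sum_prod_over_fact_le:
  fixes w :: "'a \<Rightarrow> real"
  assumes "finite I" "\<And>i. i \<in> I \<Longrightarrow> w i \<ge> 0" "s > 0" "sum w I \<le> s\<^sup>2"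
  shows "(\<Sum>J\<in>Pow I. if J = {} then 0 else prod w J / fact (card J - 1)) \<le> s * exp (2 * s)"
proof -
  have "(if J = {} then 0 else prod w J / fact (card J - 1))
      \<le> s * exp s * ((\<Prod>i\<in>J. w i / s) * (\<Prod>i\<in>I - J. 1))" if "J \<in> Pow I" for J
  proof (cases "J = {}")
    case True
    then show ?thesis using assms(3) by simp
  next
    case False
    have J: "finite J" "prod w J \<ge> 0"
      using that assms by (auto intro: finite_subset prod_nonneg)
    then obtain k where k: "card J = Suc k" using False by (metis card_0_eq not0_implies_Suc)
    have "1 / fact k \<le> exp s / s ^ k"
      using power_le_fact_mult_exp[OF assms(3), of k] assms(3) by (simp add: field_simps)
    then have "prod w J * (1 / fact k) \<le> prod w J * (exp s / s ^ k)"
      using J(2) by (rule mult_left_mono)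
    \<comment> \<open>There are \<open>k + 1\<close> factors \<open>1 / s\<close> but only
      \<open>s ^ k\<close> in the denominator; the leading \<open>s\<close> makes up for the extra
      one.\<close>
    also have "\<dots> = s * exp s * (\<Prod>i\<in>J. w i / s)"
      using assms(3) k by (simp add: prod_dividef)
    finally show ?thesis using False k by simp
  qed
  then have "(\<Sum>J\<in>Pow I. if J = {} then 0 else prod w J / fact (card J - 1))
      \<le> (\<Sum>J\<in>Pow I. s * exp s * ((\<Prod>i\<in>J. w i / s) * (\<Prod>i\<in>I - J. 1)))"
    by (rule sum_mono)
  also have "\<dots> = s * exp s * (\<Prod>i\<in>I. w i / s + 1)"
    using assms(1) by (simp add: prod_add flip: sum_distrib_left)
  also have "(\<Prod>i\<in>I. w i / s + 1) \<le> (\<Prod>i\<in>I. exp (w i / s))"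
    using assms(2,3) by (intro prod_mono) (auto simp: add.commute intro: exp_ge_add_one_self)
  also have "(\<Prod>i\<in>I. exp (w i / s)) = exp (sum w I / s)"
    using assms(1) by (simp add: exp_sum sum_divide_distrib)
  also have "\<dots> \<le> exp s"
    using assms(3,4) by (simp add: divide_le_eq power2_eq_square)
  finally show ?thesis
    using assms(3) by (simp add: mult.assoc flip: exp_add)
qed

text \<open>The \<open>n - 1\<close> inner positions weigh \<open>p\<^sup>2\<close> and the two ends
  weigh \<open>p\<close>; \<open>n > 0\<close> keeps the ends distinct.\<close>

lemma sum_end_weights:
  fixes p :: real
  assumes "n > 0"
  shows "(\<Sum>i\<le>n. p ^ (of_bool (i < n) + of_bool (0 < i))) = (real n - 1) * p\<^sup>2 + 2 * p"
proof -
  have "p ^ (of_bool (i < n) + of_bool (0 < i)) =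
      p\<^sup>2 + (if i = 0 then p - p\<^sup>2 else 0) + (if i = n then p - p\<^sup>2 else 0)" if "i \<le> n" for i
    using that assms by (auto simp: power2_eq_square)
  then have "(\<Sum>i\<le>n. p ^ (of_bool (i < n) + of_bool (0 < i))) =
      (\<Sum>i\<le>n. p\<^sup>2 + (if i = 0 then p - p\<^sup>2 else 0) + (if i = n then p - p\<^sup>2 else 0))"
    by (intro sum.cong) auto
  also have "\<dots> = real (n + 1) * p\<^sup>2 + (p - p\<^sup>2) + (p - p\<^sup>2)"
    by (simp add: sum.distrib)
  finally show ?thesis by (simp add: algebra_simps)
qed

text \<open>Write \<open>d i\<close> for the number of path edges at position \<open>i\<close>. A
  map whose positions in \<open>B\<close> form \<open>J\<close> is red with probability at most the
  product of \<open>p ^ d i\<close> over \<open>J\<close>, and with \<open>j = card J > 0\<close>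
  there are at most \<open>t ^ j * (2t)! / (j - 1)!\<close> such maps. Summing over \<open>J\<close>
  is the situation of \<open>sum_prod_over_fact_le\<close> with weights \<open>t * p ^ d i\<close>;
  the condition on \<open>s\<close> bounds their total.\<close>

lemma expected_red_maps_le:
  fixes A B :: "'a set" and p s :: real
  assumes AB: "finite A" "finite B" "A \<inter> B = {}" "card A = 2 * t" "card B = t" "t > 0"
    and p: "0 \<le> p" "p \<le> 1"
    and s: "s > 0" "real t * ((2 * real t - 1) * p\<^sup>2 + 2 * p) \<le> s\<^sup>2"
  shows "(\<Sum>S\<in>Pow (cross A B). subset_weight p (cross A B) S *
      card {f \<in> inj_maps (2 * t) (A \<union> B). \<forall>i < 2 * t. {f i, f (Suc i)} \<subseteq> A \<or> {f i, f (Suc i)} \<in> S})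
    \<le> fact (2 * t) * (s * exp (2 * s))"
    (is "?lhs \<le> _")
proof -
  let ?n = "2 * t" and ?C = "cross A B"
  let ?F = "inj_maps ?n (A \<union> B)"
  let ?red = "\<lambda>S f. \<forall>i < ?n. {f i, f (Suc i)} \<subseteq> A \<or> {f i, f (Suc i)} \<in> S"
  let ?J = "\<lambda>f. {i \<in> {..?n}. f i \<in> B}"
  let ?d = "\<lambda>i. of_bool (i < ?n) + of_bool (0 < i) :: nat"
  have fin: "finite ?C" "finite ?F" using AB(1,2) by (simp_all add: finite_cross finite_inj_maps)
  have red: "(\<Sum>S | S \<in> Pow ?C \<and> ?red S f. subset_weight p ?C S) \<le> (\<Prod>i\<in>?J f. p ^ ?d i)"
    if f: "f \<in> ?F" for f
  proof (cases "\<exists>i < ?n. f i \<in> B \<and> f (Suc i) \<in> B")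
    case True
    \<comment> \<open>Two consecutive vertices in \<open>B\<close> are joined by a blue edge, so no
      \<open>S\<close> makes the path red and the probability is 0.\<close>
    then obtain i where i: "i < ?n" "f i \<in> B" "f (Suc i) \<in> B" by blast
    have "{f i, f (Suc i)} \<notin> ?C"
      using doubleton_in_cross_iff[OF AB(3), of "f i" "f (Suc i)"] i by simp
    moreover have "\<not> {f i, f (Suc i)} \<subseteq> A" using i AB(3) by auto
    ultimately have "\<not> ?red S f" if "S \<in> Pow ?C" for S using i(1) that by blast
    then have "{S. S \<in> Pow ?C \<and> ?red S f} = {}" by blast
    then have "(\<Sum>S | S \<in> Pow ?C \<and> ?red S f. subset_weight p ?C S) = 0" by (simp only: sum.empty)
    then show ?thesis using p by (simp add: prod_nonneg)
  next
    case False
    let ?X = "{{f i, f (Suc i)} | i. i < ?n} \<inter> ?C"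
    \<comment> \<open>Crossing edges never lie inside \<open>A\<close>, so on a red path they all
      belong to \<open>S\<close>.\<close>
    have "\<not> e \<subseteq> A" if "e \<in> ?C" for e using that AB(3) by (auto simp: cross_def)
    then have "(\<Sum>S | S \<in> Pow ?C \<and> ?red S f. subset_weight p ?C S)
        \<le> (\<Sum>S | S \<subseteq> ?C \<and> ?X \<subseteq> S. subset_weight p ?C S)"
      using fin(1) p by (intro sum_mono2) (auto intro: subset_weight_nonneg)
    also have "\<dots> = p ^ card ?X" using fin(1) by (intro sum_subset_weight_superset) auto
    also have "card ?X = card {i. i < ?n \<and> (f i \<in> B) \<noteq> (f (Suc i) \<in> B)}"
      using f AB(3) by (intro card_path_edges_in_cross) (auto simp: inj_maps_def)
    also have "\<dots> = card {i. i < ?n \<and> (i \<in> ?J f) \<noteq> (Suc i \<in> ?J f)}"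
      by (intro arg_cong[where f = card]) auto
    also have "\<dots> = (\<Sum>i\<in>?J f. ?d i)"
      using False by (intro card_boundary_independent) auto
    also have "p ^ (\<Sum>i\<in>?J f. ?d i) = (\<Prod>i\<in>?J f. p ^ ?d i)" by (rule power_sum)
    finally show ?thesis .
  qed
  have fibre: "real (card {f \<in> ?F. ?J f = J}) * (\<Prod>i\<in>J. p ^ ?d i)
      \<le> fact ?n * (if J = {} then 0 else (\<Prod>i\<in>J. t * p ^ ?d i) / fact (card J - 1))"
    if J: "J \<in> Pow {..?n}" for J
  proof -
    let ?j = "card J"
    have finJ: "finite J" "?j \<le> Suc ?n"
      using J by (auto intro: finite_subset dest: card_mono[OF finite_atMost])
    have c: "card {f \<in> ?F. ?J f = J} \<le> (\<Prod>i = 0..<?j. t - i) * (\<Prod>i = 0..<Suc ?n - ?j. ?n - i)"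
      using card_inj_maps_fibre[OF AB(1-3), of J ?n] J AB(4,5) by simp
    show ?thesis
    proof (cases "J = {}")
      case True
      \<comment> \<open>All 2t + 1 positions would have to fit into the 2t vertices of
        \<open>A\<close>.\<close>
      have "(\<Prod>i = 0..<Suc ?n. ?n - i) = 0" by (simp add: prod_zero_iff)
      then have "card {f \<in> ?F. ?J f = J} = 0" using c True by simp
      then show ?thesis using True by simp
    next
      case False
      then have j: "?j \<ge> 1" using finJ by (simp add: Suc_le_eq card_gt_0_iff)
      have "(\<Prod>i = 0..<?j. t - i) \<le> (\<Prod>i = 0..<?j. t)" by (intro prod_mono) auto
      then have "(\<Prod>i = 0..<?j. t - i) \<le> t ^ ?j" by simp
      then have "card {f \<in> ?F. ?J f = J} * fact (?j - 1)
          \<le> t ^ ?j * ((\<Prod>i = 0..<Suc ?n - ?j. ?n - i) * fact (?j - 1))"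
        using c by (simp add: mult.assoc[symmetric]) (meson le_trans mult_le_mono1)
      \<comment> \<open>The positions in \<open>A\<close> use 2t + 1 - j of its 2t vertices and
        leave j - 1, whence the factorial in the denominator.\<close>
      also have "(\<Prod>i = 0..<Suc ?n - ?j. ?n - i) * fact (?j - 1) = fact ?n"
        using falling_prod_mult_fact[of "Suc ?n - ?j" ?n] j finJ(2) by simp
      finally have "real (card {f \<in> ?F. ?J f = J} * fact (?j - 1)) \<le> real (t ^ ?j * fact ?n)"
        by (rule of_nat_mono)
      then have "real (card {f \<in> ?F. ?J f = J}) \<le> fact ?n * real t ^ ?j / fact (?j - 1)"
        by (simp add: field_simps)
      then have "real (card {f \<in> ?F. ?J f = J}) * (\<Prod>i\<in>J. p ^ ?d i)
          \<le> fact ?n * real t ^ ?j / fact (?j - 1) * (\<Prod>i\<in>J. p ^ ?d i)"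
        using p by (intro mult_right_mono prod_nonneg) auto
      then show ?thesis using False by (simp add: prod.distrib)
    qed
  qed
  have "?lhs = (\<Sum>f\<in>?F. \<Sum>S | S \<in> Pow ?C \<and> ?red S f. subset_weight p ?C S)"
    using fin by (intro weighted_sum_card) auto
  also have "\<dots> \<le> (\<Sum>f\<in>?F. \<Prod>i\<in>?J f. p ^ ?d i)" by (rule sum_mono) (rule red)
  also have "\<dots> = (\<Sum>J\<in>Pow {..?n}. \<Sum>f | f \<in> ?F \<and> ?J f = J. \<Prod>i\<in>?J f. p ^ ?d i)"
    using fin(2) by (intro sum.group[symmetric]) auto
  also have "\<dots> = (\<Sum>J\<in>Pow {..?n}. real (card {f \<in> ?F. ?J f = J}) * (\<Prod>i\<in>J. p ^ ?d i))"
    by (intro sum.cong refl) simp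
  also have "\<dots> \<le> (\<Sum>J\<in>Pow {..?n}. fact ?n *
      (if J = {} then 0 else (\<Prod>i\<in>J. t * p ^ ?d i) / fact (card J - 1)))"
    by (rule sum_mono) (rule fibre)
  also have "\<dots> = fact ?n * (\<Sum>J\<in>Pow {..?n}.
      if J = {} then 0 else (\<Prod>i\<in>J. t * p ^ ?d i) / fact (card J - 1))"
    by (rule sum_distrib_left[symmetric])
  also have "\<dots> \<le> fact ?n * (s * exp (2 * s))"
  proof (intro mult_left_mono sum_prod_over_fact_le)
    have "(\<Sum>i\<le>?n. t * p ^ ?d i) = t * ((real ?n - 1) * p\<^sup>2 + 2 * p)"
      unfolding sum_distrib_left[symmetric] using sum_end_weights[of ?n p] AB(6) by simp
    then show "(\<Sum>i\<le>?n. t * p ^ ?d i) \<le> s\<^sup>2" using s(2) by simp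
  qed (use p s(1) in auto)
  finally show ?thesis .
qed

text \<open>A blue path has no edge inside \<open>A\<close>, while at least t + 1 of its 2t + 1
  vertices lie in \<open>A\<close>, so \<open>A\<close> occupies exactly the even positions. All 2t
  edges then cross and must avoid \<open>S\<close>, and there are at most t! * (2t)! / (t - 1)! = t
  * (2t)! such maps.\<close>

lemma expected_blue_maps_le:
  fixes A B :: "'a set" and p :: real
  assumes AB: "finite A" "finite B" "A \<inter> B = {}" "card A = 2 * t" "card B = t" "t > 0"
    and p: "0 \<le> p" "p \<le> 1"
  shows "(\<Sum>S\<in>Pow (cross A B). subset_weight p (cross A B) S *
      card {f \<in> inj_maps (2 * t) (A \<union> B). \<forall>i < 2 * t. \<not> {f i, f (Suc i)} \<subseteq> A \<and> {f i, f (Suc i)} \<notin> S})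
    \<le> fact (2 * t) * (real t * (1 - p) ^ (2 * t))"
    (is "?lhs \<le> _")
proof -
  let ?n = "2 * t" and ?C = "cross A B"
  let ?F = "inj_maps ?n (A \<union> B)"
  let ?blue = "\<lambda>S f. \<forall>i < ?n. \<not> {f i, f (Suc i)} \<subseteq> A \<and> {f i, f (Suc i)} \<notin> S"
  let ?J = "\<lambda>f. {i \<in> {..?n}. f i \<in> B}"
  let ?odd = "{i \<in> {..?n}. odd i}"
  have fin: "finite ?C" "finite ?F" using AB(1,2) by (simp_all add: finite_cross finite_inj_maps)
  have bij: "bij_betw (\<lambda>i. 2 * i + 1) {..<t} ?odd"
    by (auto simp: bij_betw_def inj_on_def image_iff elim!: oddE)
  then have card_odd: "card ?odd = t" using bij_betw_same_card by fastforce
  have blue: "(\<Sum>S | S \<in> Pow ?C \<and> ?blue S f. subset_weight p ?C S)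
      \<le> (if ?J f = ?odd then (1 - p) ^ ?n else 0)" if f: "f \<in> ?F" for f
  proof (cases "\<exists>S. ?blue S f")
    case False
    then have "(\<Sum>S | S \<in> Pow ?C \<and> ?blue S f. subset_weight p ?C S) = 0"
      by (intro sum.neutral) blast
    then show ?thesis using p by simp
  next
    case True
    then have noA: "\<not> {f i, f (Suc i)} \<subseteq> A" if "i < ?n" for i using that by blast
    have fAB: "f i \<in> A \<union> B" if "i \<le> ?n" for i
      using f that by (auto simp: inj_maps_def)
    have inj: "inj_on f {..?n}" using f by (simp add: inj_maps_def)
    have "card (?J f) \<le> t"
      using card_inj_on_le[of f "?J f" B] inj AB(2,5) by (auto intro: inj_on_subset)
    then have "card ({..?n} - ?J f) \<ge> t + 1" by (subst card_Diff_subset) auto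
    moreover have "Suc i \<notin> {..?n} - ?J f" if "i \<in> {..?n} - ?J f" for i
      using noA[of i] fAB[of i] fAB[of "Suc i"] that by auto
    ultimately have "{..?n} - ?J f = {i. i \<le> ?n \<and> even i}"
      by (intro independent_eq_evens) auto
    then have J: "?J f = ?odd" by auto
    let ?X = "{{f i, f (Suc i)} | i. i < ?n} \<inter> ?C"
    have "(\<Sum>S | S \<in> Pow ?C \<and> ?blue S f. subset_weight p ?C S)
        \<le> (\<Sum>S | S \<subseteq> ?C \<and> S \<inter> ?X = {}. subset_weight p ?C S)"
      using fin(1) p by (intro sum_mono2) (auto intro: subset_weight_nonneg)
    also have "\<dots> = (1 - p) ^ card ?X" using fin(1) by (intro sum_subset_weight_disjoint) auto
    also have "card ?X = card {i. i < ?n \<and> (f i \<in> B) \<noteq> (f (Suc i) \<in> B)}"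
      using f AB(3) by (intro card_path_edges_in_cross) (auto simp: inj_maps_def)
    also have "{i. i < ?n \<and> (f i \<in> B) \<noteq> (f (Suc i) \<in> B)} = {..<?n}"
    proof -
      have "f i \<in> B \<longleftrightarrow> odd i" if "i \<le> ?n" for i
        using J that by (auto simp: set_eq_iff)
      then show ?thesis by auto
    qed
    finally show ?thesis using J by simp
  qed
  have "card {f \<in> ?F. ?J f = ?odd} \<le> (\<Prod>i = 0..<t. t - i) * (\<Prod>i = 0..<Suc ?n - t. ?n - i)"
    using card_inj_maps_fibre[OF AB(1-3), of ?odd ?n] unfolding card_odd AB(4,5) by blast
  also have "(\<Prod>i = 0..<t. t - i) = fact t" using falling_prod_mult_fact[of t t] by simp
  also have "fact t = t * (fact (t - 1) :: nat)" using AB(6) by (simp add: fact_reduce)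
  also have "t * fact (t - 1) * (\<Prod>i = 0..<Suc ?n - t. ?n - i) = t * fact ?n"
  proof -
    have "Suc ?n - t \<le> ?n" "?n - (Suc ?n - t) = t - 1" using AB(6) by auto
    then have "(\<Prod>i = 0..<Suc ?n - t. ?n - i) * fact (t - 1) = (fact ?n :: nat)"
      using falling_prod_mult_fact[of "Suc ?n - t" ?n] by metis
    then show ?thesis by (metis mult.assoc mult.commute)
  qed
  finally have "real (card {f \<in> ?F. ?J f = ?odd}) \<le> real (t * fact ?n)" by (rule of_nat_mono)
  then have card: "real (card {f \<in> ?F. ?J f = ?odd}) \<le> real t * fact ?n" by simp
  have "?lhs = (\<Sum>f\<in>?F. \<Sum>S | S \<in> Pow ?C \<and> ?blue S f. subset_weight p ?C S)"
    using fin by (intro weighted_sum_card) auto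
  also have "\<dots> \<le> (\<Sum>f\<in>?F. if ?J f = ?odd then (1 - p) ^ ?n else 0)"
    by (rule sum_mono) (rule blue)
  also have "\<dots> = real (card {f \<in> ?F. ?J f = ?odd}) * (1 - p) ^ ?n"
    using fin(2) by (simp add: sum.inter_filter[symmetric])
  also have "\<dots> \<le> real t * fact ?n * (1 - p) ^ ?n"
    using card p by (intro mult_right_mono) auto
  finally show ?thesis by (simp add: mult_ac)
qed

section \<open>The multiplicity bound\<close>

lemma copies_mono: "subgraph_of G K \<Longrightarrow> copies H G \<subseteq> copies H K"
  by (auto simp: copies_def subgraph_of_def)

lemma finite_copies: "finite (fst G) \<Longrightarrow> finite (snd G) \<Longrightarrow> finite (copies H G)"
  by (rule finite_subset[of _ "Pow (fst G) \<times> Pow (snd G)"])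
    (auto simp: copies_def subgraph_of_def)

lemma mono_count_mono:
  assumes "m \<le> n"
  shows "mono_count H m c \<le> mono_count H n c"
proof -
  have "finite (copies H (colour_graph n c k))" for k
    by (rule finite_copies) (auto simp: colour_graph_def finite_imp_finite_nsets)
  moreover have "subgraph_of (colour_graph m c k) (colour_graph n c k)" for k
    using assms nsets_mono[of "{..<m}" "{..<n}" 2] by (auto simp: colour_graph_def subgraph_of_def)
  ultimately show ?thesis
    unfolding mono_count_def by (intro add_mono card_mono copies_mono)
qed

text \<open>A colouring on \<open>n\<close> vertices restricts to one on
  \<open>ramsey_number H\<close> vertices with no more monochromatic copies.\<close>

lemma ramsey_multiplicity_le_mono_count:
  assumes "ramsey_number H \<le> n"
  shows "ramsey_multiplicity H \<le> mono_count H n c"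
proof -
  have "ramsey_multiplicity H \<le> mono_count H (ramsey_number H) c"
    unfolding ramsey_multiplicity_def by (rule Least_le) blast
  also have "\<dots> \<le> mono_count H n c" by (rule mono_count_mono) fact
  finally show ?thesis .
qed

text \<open>Some set \<open>S\<close> of crossing edges has \<open>g S\<close> at most its average,
  and every monochromatic copy under \<open>col S\<close> is traced by a map counted in
  \<open>g S\<close>.\<close>

lemma ramsey_multiplicity_path_le:
  fixes p s :: real
  assumes t: "t > 0" and p: "0 \<le> p" "p \<le> 1"
    and s: "s > 0" "real t * ((2 * real t - 1) * p\<^sup>2 + 2 * p) \<le> s\<^sup>2"
  shows "real (ramsey_multiplicity (path_graph (2 * t + 1)))
    \<le> fact (2 * t) * (real t * (1 - p) ^ (2 * t) + s * exp (2 * s))"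
proof -
  define A B where "A = {..<2 * t}" and "B = {2 * t..<3 * t}"
  let ?C = "cross A B" and ?P = "path_graph (2 * t + 1)"
  let ?F = "inj_maps (2 * t) (A \<union> B)"
  let ?red = "\<lambda>S f. \<forall>i < 2 * t. {f i, f (Suc i)} \<subseteq> A \<or> {f i, f (Suc i)} \<in> S"
  let ?blue = "\<lambda>S f. \<forall>i < 2 * t. \<not> {f i, f (Suc i)} \<subseteq> A \<and> {f i, f (Suc i)} \<notin> S"
  define g where "g = (\<lambda>S. real (card {f \<in> ?F. ?red S f}) + real (card {f \<in> ?F. ?blue S f}))"
  \<comment> \<open>For \<open>S\<close> within \<open>cross A B\<close> this is red inside
    \<open>A\<close>, blue inside \<open>B\<close>, and decided by \<open>S\<close> in
    between.\<close>
  define col where "col = (\<lambda>S e. if e \<subseteq> A \<or> e \<in> S then Red else Blue)"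
  have AB: "finite A" "finite B" "A \<inter> B = {}" "card A = 2 * t" "card B = t" "A \<union> B = {..<3 * t}"
    by (auto simp: A_def B_def)
  have fin: "finite (Pow ?C)" "finite ?F" using AB(1,2) by (simp_all add: finite_cross finite_inj_maps)
  have "\<exists>S\<in>Pow ?C. g S \<le> (\<Sum>S\<in>Pow ?C. subset_weight p ?C S * g S)"
    using fin(1) p AB(1,2)
    by (intro exists_le_weighted_average subset_weight_nonneg sum_subset_weight finite_cross)
  then obtain S where "g S \<le> (\<Sum>S\<in>Pow ?C. subset_weight p ?C S * g S)" by blast
  also have "\<dots> = (\<Sum>S\<in>Pow ?C. subset_weight p ?C S * card {f \<in> ?F. ?red S f}) +
      (\<Sum>S\<in>Pow ?C. subset_weight p ?C S * card {f \<in> ?F. ?blue S f})"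
    by (simp add: g_def distrib_left sum.distrib)
  also have "\<dots> \<le> fact (2 * t) * (s * exp (2 * s)) + fact (2 * t) * (real t * (1 - p) ^ (2 * t))"
    using AB t p s by (intro add_mono expected_red_maps_le expected_blue_maps_le)
  finally have g: "g S \<le> fact (2 * t) * (real t * (1 - p) ^ (2 * t) + s * exp (2 * s))"
    by (simp add: algebra_simps)
  have red: "path_maps (2 * t + 1) (colour_graph (3 * t) (col S) Red) \<subseteq> {f \<in> ?F. ?red S f}"
    by (auto simp: path_maps_def inj_maps_def colour_graph_def AB(6) col_def lessThan_Suc_atMost
        split: if_splits)
  have blue: "path_maps (2 * t + 1) (colour_graph (3 * t) (col S) Blue) \<subseteq> {f \<in> ?F. ?blue S f}"
    by (auto simp: path_maps_def inj_maps_def colour_graph_def AB(6) col_def lessThan_Suc_atMost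
        split: if_splits)
  have "ramsey_multiplicity ?P \<le> mono_count ?P (3 * t) (col S)"
    by (intro ramsey_multiplicity_le_mono_count ramsey_number_path_le t)
  also have "\<dots> \<le> card {f \<in> ?F. ?red S f} + card {f \<in> ?F. ?blue S f}"
    unfolding mono_count_def using fin(2)
    by (intro add_mono order_trans[OF card_copies_path_le] card_mono red blue)
      (auto simp: colour_graph_def)
  finally have "real (ramsey_multiplicity ?P) \<le> g S" unfolding g_def by linarith
  with g show ?thesis by simp
qed

section \<open>Balancing the two colours\<close>

lemma ln_affine_ln_over_ln_tendsto_0:
  fixes a b :: real
  assumes "a > 0"
  shows "(\<lambda>t. ln (b + a * ln (real t)) / ln (real t)) \<longlonglongrightarrow> 0"
  using assms by real_asymp

theorem theorem4:
  shows "\<exists>\<epsilon> :: nat \<Rightarrow> real. \<epsilon> \<longlonglongrightarrow> 0 \<and>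
    (\<forall>\<^sub>F t in sequentially.
       real (ramsey_multiplicity (path_graph (2 * t + 1)))
         \<le> real t powr (- 1 / (1 + sqrt 2) + \<epsilon> t) * (real t / 2) * fact (2 * t))"
proof -
  \<comment> \<open>This is 1 / (1 + sqrt 2), the solution of \<open>sqrt 2 * c = 1 - c\<close> that
    makes the red and blue bounds agree up to a factor linear in \<open>ln t\<close>.\<close>
  define c where "c = sqrt 2 - (1::real)"
  \<comment> \<open>Twice the constant in \<open>s * exp (2 * s)\<close> for the \<open>s\<close>
    chosen below.\<close>
  define a where "a = sqrt 2 * exp (sqrt 2)"
  \<comment> \<open>Chosen so that \<open>t powr \<epsilon> t\<close> is the logarithmic factor left
    over beside \<open>t powr (- c)\<close>.\<close>
  define \<epsilon> where "\<epsilon> = (\<lambda>t. ln ((2 + a) + a * c * ln (real t)) / ln (real t))"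
  have "c * (1 + sqrt 2) = 1" by (simp add: c_def algebra_simps)
  then have "c = 1 / (1 + sqrt 2)"
    by (metis eq_divide_imp mult_zero_right zero_neq_one)
  moreover have "c > 0" "c < 1" "sqrt 2 * c = 1 - c"
    using sqrt2_less_2 by (simp_all add: c_def algebra_simps)
  ultimately have c: "c > 0" "c < 1" "sqrt 2 * c = 1 - c" "- 1 / (1 + sqrt 2) = - c"
    by simp_all
  have a: "a > 0" by (simp add: a_def)
  have bound: "real (ramsey_multiplicity (path_graph (2 * t + 1)))
      \<le> real t powr (- 1 / (1 + sqrt 2) + \<epsilon> t) * (real t / 2) * fact (2 * t)" if t: "t \<ge> 2" for t
  proof -
    define L where "L = ln (real t)"
    define C where "C = c * L"
    \<comment> \<open>Thus \<open>C\<close> is the mean number of red edges among the 2t edges of an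
      alternating path.\<close>
    define p where "p = C / (2 * real t)"
    \<comment> \<open>The lower bound required of \<open>s\<^sup>2\<close> is at most
      \<open>C\<^sup>2 / 2 + C\<close>; completing the square makes \<open>s\<close> linear in
      \<open>C\<close>.\<close>
    define s where "s = (C + 1) / sqrt 2"
    have L: "0 < L" "L \<le> real t" using t less_imp_le[OF ln_less_self[of "real t"]] by (simp_all add: L_def)
    have C: "0 < C" "C \<le> real t"
      using c(1,2) L mult_mono[of c 1 L "real t"] by (auto simp: C_def)
    have powr: "real t powr x = exp (x * L)" for x using t by (simp add: powr_def L_def)
    have p: "0 \<le> p" "p \<le> 1" using C t by (auto simp: p_def)
    have "2 * real t * p = C" using t by (simp add: p_def)
    then have "real t * ((2 * real t - 1) * p\<^sup>2 + 2 * p) = C\<^sup>2 / 2 + C - real t * p\<^sup>2"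
      by (simp add: power2_eq_square algebra_simps)
    also have "\<dots> \<le> s\<^sup>2"
    proof -
      have "s\<^sup>2 = C\<^sup>2 / 2 + C + 1 / 2"
        by (simp add: s_def power_divide power2_sum add_divide_distrib)
      moreover have "0 \<le> real t * p\<^sup>2" by simp
      ultimately show ?thesis by linarith
    qed
    finally have "real (ramsey_multiplicity (path_graph (2 * t + 1)))
        \<le> fact (2 * t) * (real t * (1 - p) ^ (2 * t) + s * exp (2 * s))"
      using t p C(1) by (intro ramsey_multiplicity_path_le) (auto simp: s_def)
    also have "\<dots> \<le> fact (2 * t) * (real t * exp (- C) + s * exp (2 * s))"
    proof -
      have "(1 - p) ^ (2 * t) \<le> exp (- p) ^ (2 * t)"
        using p exp_ge_add_one_self[of "- p"] by (intro power_mono) auto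
      also have "\<dots> = exp (- C)"
        using \<open>2 * real t * p = C\<close> by (simp flip: exp_of_nat_mult)
      finally show ?thesis by (intro mult_left_mono add_right_mono) auto
    qed
    also have "s * exp (2 * s) = a / 2 * (C + 1) * (real t * exp (- C))"
    proof -
      have "2 * s = sqrt 2 * (C + 1)" by (simp add: s_def real_div_sqrt field_simps)
      also have "\<dots> = sqrt 2 * c * L + sqrt 2" by (simp add: C_def algebra_simps)
      \<comment> \<open>Here the choice of \<open>c\<close> acts: up to a constant,
        \<open>exp (2 * s)\<close> becomes the blue term \<open>t * exp (- C)\<close>.\<close>
      also have "\<dots> = (1 - c) * L + sqrt 2" by (simp only: c(3))
      finally have "exp (2 * s) = exp (sqrt 2) * (exp L * exp (- C))"
        by (simp add: C_def algebra_simps flip: exp_add)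
      also have "exp L = real t" using t by (simp add: L_def)
      finally have "s * exp (2 * s) = s * (exp (sqrt 2) * (real t * exp (- C)))" by (rule arg_cong)
      also have "\<dots> = a / 2 * (C + 1) * (real t * exp (- C))"
      proof -
        have "s = sqrt 2 / 2 * (C + 1)" by (simp add: s_def field_simps)
        then show ?thesis by (simp add: a_def)
      qed
      finally show ?thesis .
    qed
    \<comment> \<open>With \<open>t / 2\<close> taken out, the blue term leaves 2 and the red one
      \<open>a + a * c * L\<close>.\<close>
    also have "fact (2 * t) * (real t * exp (- C) + a / 2 * (C + 1) * (real t * exp (- C))) =
        exp (- C) * (2 + a + a * c * L) * (real t / 2) * fact (2 * t)"
      by (simp add: C_def field_simps)
    also have "exp (- C) = real t powr (- c)" by (simp add: powr C_def)
    also have "2 + a + a * c * L = real t powr \<epsilon> t"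
    proof -
      have "0 < 2 + a + a * c * L" using a c(1) L(1) by (simp add: add_pos_pos)
      then show ?thesis using L(1) by (simp add: powr \<epsilon>_def flip: L_def)
    qed
    finally show ?thesis unfolding c(4) powr_add .
  qed
  \<comment> \<open>The numerator grows only like \<open>ln (ln t)\<close>.\<close>
  have "\<epsilon> \<longlonglongrightarrow> 0"
    unfolding \<epsilon>_def using a c(1) by (intro ln_affine_ln_over_ln_tendsto_0) simp
  moreover have "\<forall>\<^sub>F t in sequentially. real (ramsey_multiplicity (path_graph (2 * t + 1)))
      \<le> real t powr (- 1 / (1 + sqrt 2) + \<epsilon> t) * (real t / 2) * fact (2 * t)"
    using eventually_ge_at_top[of "2::nat"] by eventually_elim (rule bound)
  ultimately show ?thesis by blast
qed

end
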